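(* Let $n\ge 3$, $d=\lfloor n/2\rfloor$, and let $c_1,\dots,c_d\ge 0$ be the stripe costs of a symmetric circulant TSP instance on $K_n$, with stripe permutation $\phi$, $g$-sequence $g=g^{\phi}$, and $\ell=\min\{i:1\le i\le d,\ g_i=1\}$. Let $\mathrm{LPOPT}$ be the optimal value of the subtour LP and $$\mathrm{VDV}=\Big(\sum_{i=1}^{\ell}(g_{i-1}-g_i)c_{\phi(i)}\Big)+c_{\phi(\ell)}.$$ Then $\mathrm{VDV}=\mathrm{LPOPT}$. Moreover, an optimal solution $x$ to the subtour LP is obtained by setting, for each $1\le i\le d$ and every edge $e$ of length $\phi(i)$, $$x_e=\begin{cases}\frac{g_{i-1}-g_i}{n}, & i\ne \ell,\ \phi(i)\ne n/2,\\ 2\frac{g_{i-1}-g_i}{n}, & i\ne\ell,\ \phi(i)=n/2,\\ \frac{g_{i-1}}{n}, & i=\ell,\ \phi(i)\ne n/2,\\ 2\frac{g_{i-1}}{n}, & i=\ell,\ \phi(i)=n/2,\end{cases}$$ and $x_e=0$ for edges of length $\phi(i)$ with $i>\ell$.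
   Context: Vertices are $V=[n]=\{1,\dots,n\}$, $E$ is the edge set of $K_n$, and arithmetic on vertices is mod $n$. In a symmetric circulant instance, the cost of edge $\{i,j\}$ depends only on its length $k=\min\{(i-j)\bmod n,(j-i)\bmod n\}\in\{1,\dots,d\}$ and equals $c_k$; the set of edges of length $k$ is the $k$-th stripe. A stripe permutation is a permutation $\phi$ of $[d]$ with $c_{\phi(1)}\le\cdots\le c_{\phi(d)}$. Its $g$-sequence is $g_0=n$ and $g_i=\gcd(\phi(i),g_{i-1})$ for $1\le i\le d$. The subtour LP is: minimize $\sum_{e\in E}c_ex_e$ subject to $\sum_{e\in\delta(v)}x_e=2$ for all $v\in V$, $\sum_{e\in\delta(S)}x_e\ge 2$ for all $\emptyset\ne S\subsetneq V$, and $0\le x_e\le 1$ for all $e\in E$, where $\delta(S)$ is the set of edges with exactly one endpoint in $S$ and $\delta(v)=\delta(\{v\})$. *)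

theory Defs
  imports Complex_Main "HOL-Combinatorics.Permutations"
begin

section \<open>Circulant instances on the complete graph\<close>

definition vertices :: "nat \<Rightarrow> nat set" where
  "vertices n = {1..n}"

definition edges :: "nat \<Rightarrow> nat set set" where
  "edges n = {e. e \<subseteq> vertices n \<and> card e = 2}"

text \<open>The differences are taken over the integers: truncated subtraction on natural
  numbers would give a wrong residue.\<close>

definition circ_dist :: "nat \<Rightarrow> nat \<Rightarrow> nat \<Rightarrow> nat" where
  "circ_dist n i j = nat (min ((int i - int j) mod int n) ((int j - int i) mod int n))"

definition stripe :: "nat \<Rightarrow> nat \<Rightarrow> nat set set" where
  "stripe n k = {{i, j} |i j. {i, j} \<in> edges n \<and> circ_dist n i j = k}"

definition edge_length :: "nat \<Rightarrow> nat set \<Rightarrow> nat" where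
  "edge_length n e = (THE k. e \<in> stripe n k)"

definition edge_cost :: "nat \<Rightarrow> (nat \<Rightarrow> real) \<Rightarrow> nat set \<Rightarrow> real" where
  "edge_cost n c e = c (edge_length n e)"

lemma circ_dist_commute: "circ_dist n i j = circ_dist n j i"
  by (simp add: circ_dist_def min.commute)

lemma edge_length_stripe:
  assumes "e \<in> stripe n k"
  shows "edge_length n e = k"
  unfolding edge_length_def
proof (rule the_equality)
  show "e \<in> stripe n k" by fact
next
  fix k' assume "e \<in> stripe n k'"
  with assms show "k' = k"
    by (auto simp: stripe_def doubleton_eq_iff circ_dist_commute)
qed

lemma edge_length_doubleton:
  assumes "{i, j} \<in> edges n"
  shows "edge_length n {i, j} = circ_dist n i j"
  by (rule edge_length_stripe) (use assms in \<open>auto simp: stripe_def\<close>)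

section \<open>The subtour LP\<close>

definition cut :: "nat \<Rightarrow> nat set \<Rightarrow> nat set set" where
  "cut n S = {e \<in> edges n. card (e \<inter> S) = 1}"

text \<open>Points of the LP are functions on all sets of naturals; only their values on
  \<open>edges n\<close> matter for feasibility and for the objective.\<close>

definition subtour_feasible :: "nat \<Rightarrow> (nat set \<Rightarrow> real) \<Rightarrow> bool" where
  "subtour_feasible n x \<longleftrightarrow>
     (\<forall>v\<in>vertices n. (\<Sum>e\<in>cut n {v}. x e) = 2) \<and>
     (\<forall>S. S \<noteq> {} \<and> S \<subset> vertices n \<longrightarrow> (\<Sum>e\<in>cut n S. x e) \<ge> 2) \<and>
     (\<forall>e\<in>edges n. 0 \<le> x e \<and> x e \<le> 1)"

definition objective :: "nat \<Rightarrow> (nat set \<Rightarrow> real) \<Rightarrow> (nat set \<Rightarrow> real) \<Rightarrow> real" where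
  "objective n w x = (\<Sum>e\<in>edges n. w e * x e)"

definition subtour_optimal :: "nat \<Rightarrow> (nat set \<Rightarrow> real) \<Rightarrow> (nat set \<Rightarrow> real) \<Rightarrow> bool" where
  "subtour_optimal n w x \<longleftrightarrow>
     subtour_feasible n x \<and>
     (\<forall>y. subtour_feasible n y \<longrightarrow> objective n w x \<le> objective n w y)"

definition LPOPT :: "nat \<Rightarrow> (nat set \<Rightarrow> real) \<Rightarrow> real" where
  "LPOPT n w = (INF x\<in>{x. subtour_feasible n x}. objective n w x)"

text \<open>As the real infimum is unspecified on the empty set, this relates \<open>LPOPT\<close> to
  attained minima.\<close>

lemma LPOPT_eq_objective:
  assumes "subtour_optimal n w x"
  shows "LPOPT n w = objective n w x"
  unfolding LPOPT_def
  by (rule cInf_eq_minimum) (use assms in \<open>auto simp: subtour_optimal_def\<close>)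

section \<open>Stripe permutations\<close>

definition stripe_permutation :: "nat \<Rightarrow> (nat \<Rightarrow> real) \<Rightarrow> (nat \<Rightarrow> nat) \<Rightarrow> bool" where
  "stripe_permutation n c \<phi> \<longleftrightarrow>
     \<phi> permutes {1..n div 2} \<and> mono_on {1..n div 2} (\<lambda>i. c (\<phi> i))"

primrec g_seq :: "nat \<Rightarrow> (nat \<Rightarrow> nat) \<Rightarrow> nat \<Rightarrow> nat" where
  "g_seq n \<phi> 0 = n"
| "g_seq n \<phi> (Suc i) = gcd (\<phi> (Suc i)) (g_seq n \<phi> i)"

definition ell :: "nat \<Rightarrow> (nat \<Rightarrow> nat) \<Rightarrow> nat" where
  "ell n \<phi> = (LEAST i. 1 \<le> i \<and> i \<le> n div 2 \<and> g_seq n \<phi> i = 1)"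

lemma g_seq_dvd:
  assumes "1 \<le> i" "i \<le> m"
  shows "g_seq n \<phi> m dvd \<phi> i"
  using assms(2,1)
proof (induction m rule: dec_induct)
  case base
  then show ?case by (cases i) auto
next
  case (step m)
  then show ?case by (auto intro: dvd_trans[OF gcd_dvd2])
qed

lemma ell_props:
  assumes "n \<ge> 2" and "\<phi> permutes {1..n div 2}"
  shows "1 \<le> ell n \<phi>" "ell n \<phi> \<le> n div 2" "g_seq n \<phi> (ell n \<phi>) = 1"
proof -
  have "1 \<in> \<phi> ` {1..n div 2}"
    using assms by (simp add: permutes_image)
  then obtain i where "i \<in> {1..n div 2}" "\<phi> i = 1" by auto
  then have "1 \<le> n div 2 \<and> n div 2 \<le> n div 2 \<and> g_seq n \<phi> (n div 2) = 1"
    using g_seq_dvd[of i "n div 2" n \<phi>] by auto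
  from LeastI[of "\<lambda>i. 1 \<le> i \<and> i \<le> n div 2 \<and> g_seq n \<phi> i = 1", OF this]
  show "1 \<le> ell n \<phi>" "ell n \<phi> \<le> n div 2" "g_seq n \<phi> (ell n \<phi>) = 1"
    by (simp_all add: ell_def)
qed

definition VDV :: "nat \<Rightarrow> (nat \<Rightarrow> real) \<Rightarrow> (nat \<Rightarrow> nat) \<Rightarrow> real" where
  "VDV n c \<phi> =
     (\<Sum>i = 1..ell n \<phi>. (real (g_seq n \<phi> (i - 1)) - real (g_seq n \<phi> i)) * c (\<phi> i))
     + c (\<phi> (ell n \<phi>))"

text \<open>The condition \<open>2 * \<phi> i = n\<close> expresses that \<open>\<phi> i\<close> is exactly half of \<open>n\<close>; with
  \<open>n div 2\<close> it could also hold for odd \<open>n\<close>.\<close>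

definition stripe_weight :: "nat \<Rightarrow> (nat \<Rightarrow> nat) \<Rightarrow> nat \<Rightarrow> real" where
  "stripe_weight n \<phi> i =
     (if i > ell n \<phi> then 0
      else if i \<noteq> ell n \<phi> then
        (if 2 * \<phi> i \<noteq> n
         then (real (g_seq n \<phi> (i - 1)) - real (g_seq n \<phi> i)) / real n
         else 2 * ((real (g_seq n \<phi> (i - 1)) - real (g_seq n \<phi> i)) / real n))
      else
        (if 2 * \<phi> i \<noteq> n
         then real (g_seq n \<phi> (i - 1)) / real n
         else 2 * (real (g_seq n \<phi> (i - 1)) / real n)))"

definition stripe_solution :: "nat \<Rightarrow> (nat \<Rightarrow> nat) \<Rightarrow> nat set \<Rightarrow> real" where
  "stripe_solution n \<phi> e = stripe_weight n \<phi> (inv \<phi> (edge_length n e))"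

lemma stripe_solution_stripe:
  assumes "\<phi> permutes {1..n div 2}" and "e \<in> stripe n (\<phi> i)"
  shows "stripe_solution n \<phi> e = stripe_weight n \<phi> i"
  using assms by (simp add: stripe_solution_def edge_length_stripe permutes_inverses)

end

theory Submission
  imports Defs "HOL-Number_Theory.Cong"
begin

text \<open>Feasibility. Let \<open>f\<close> be the indicator of a nonempty proper set \<open>S\<close> of residues mod \<open>n\<close>. The
  residue classes mod \<open>g\<^sub>i\<close> are the cosets of the subgroup generated by the first \<open>i\<close> lengths, and
  each of them is a cycle, under translation by \<open>\<phi> i\<close>, of classes mod \<open>g\<^sub>i\<^sub>-\<^sub>1\<close>. The number of edges
  of length \<open>\<phi> i\<close> leaving \<open>S\<close> inside such a cycle is at least twice the difference of the numbers
  of elements of \<open>S\<close> in any two of its members. By induction on \<open>i\<close>, the cut inside a class mod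
  \<open>g\<^sub>i\<close> with \<open>t > 0\<close> elements of \<open>S\<close> has (scaled) weight at least \<open>2 n - 2 g\<^sub>i t\<close>; applied to the
  classes mod \<open>g\<^sub>\<ell>\<^sub>-\<^sub>1\<close> and to the complement of \<open>S\<close>, this gives every cut constraint.

  Optimality. For \<open>j < \<ell>\<close>, adding the cut constraints of the \<open>g\<^sub>j\<close> residue classes mod \<open>g\<^sub>j\<close> shows
  that a feasible point has total weight at least \<open>g\<^sub>j\<close> on the lengths not divisible by \<open>g\<^sub>j\<close>, hence
  on the lengths \<open>\<phi> i\<close> with \<open>i > j\<close>. Summation by parts then bounds its cost by VDV.\<close>

section \<open>Cuts along chains of residue classes\<close>

text \<open>Representatives are integers so that translation by a length never truncates. As
  \<open>x\<close> may be any integer, the \<open>s\<close>-th class of a cycle can be addressed by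
  \<open>x + int (s * k)\<close> without reduction.\<close>

definition residue_class :: "nat \<Rightarrow> nat \<Rightarrow> int \<Rightarrow> int set" where
  "residue_class n g x = {v \<in> {0..<int n}. v mod int g = x mod int g}"

lemma finite_residue_class [simp]: "finite (residue_class n g x)"
  by (rule finite_subset[of _ "{0..<int n}"]) (auto simp: residue_class_def)

lemma residue_class_cong:
  "x mod int g = y mod int g \<Longrightarrow> residue_class n g x = residue_class n g y"
  by (simp add: residue_class_def)

lemma residue_class_modulus: "n > 0 \<Longrightarrow> residue_class n n x = {x mod int n}"
  by (auto simp: residue_class_def)

lemma residue_class_Suc_0: "residue_class n (Suc 0) x = {0..<int n}"
  by (auto simp: residue_class_def)

text \<open>Since g divides n, reduction mod n respects classes mod g, so translation by k followed
  by this reduction is a bijection between two classes; periodicity of \<open>f\<close> absorbs the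
  reduction.\<close>

lemma sum_residue_class_shift:
  fixes f :: "int \<Rightarrow> real"
  assumes "n > 0" "g dvd n" and per: "\<And>v. f (v mod int n) = f v"
  shows "(\<Sum>v\<in>residue_class n g x. f (v + k)) = (\<Sum>v\<in>residue_class n g (x + k). f v)"
proof (rule sum.reindex_bij_witness[where i = "\<lambda>v. (v - k) mod int n" and j = "\<lambda>v. (v + k) mod int n"])
  have d: "int g dvd int n" using assms by simp
  fix v
  { assume "v \<in> residue_class n g x"
    then show "((v + k) mod int n - k) mod int n = v"
      by (simp add: residue_class_def mod_simps)
    from \<open>v \<in> residue_class n g x\<close> show "(v + k) mod int n \<in> residue_class n g (x + k)"
      using assms(1) by (auto simp: residue_class_def mod_mod_cancel[OF d] intro: mod_add_cong)
    show "f ((v + k) mod int n) = f (v + k)" by (rule per) }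
  { assume "v \<in> residue_class n g (x + k)"
    then show "((v - k) mod int n + k) mod int n = v"
      by (simp add: residue_class_def mod_simps)
    from \<open>v \<in> residue_class n g (x + k)\<close> have "(v - k) mod int g = (x + k - k) mod int g"
      by (intro mod_diff_cong) (auto simp: residue_class_def)
    then show "(v - k) mod int n \<in> residue_class n g x"
      using assms(1) by (auto simp: residue_class_def mod_mod_cancel[OF d]) }
qed

text \<open>In Z/p the element k has order p/g and generates the multiples of g. Hence s k for s <
  p/g runs through these multiples once each, which lists the classes mod p inside a class mod g in
  the cyclic order of translation by k.\<close>

lemma sum_residue_class_refine:
  fixes F :: "int \<Rightarrow> real"
  assumes "p > 0" and g: "g = gcd k p"
  shows "(\<Sum>v\<in>residue_class n g x. F v) =
         (\<Sum>s<p div g. \<Sum>v\<in>residue_class n p (x + int (s * k)). F v)"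
proof -
  define r where "r = p div g"
  have gpos: "g > 0" using assms by simp
  obtain k' where k': "k = g * k'" using g by (metis gcd_dvd1 dvdE)
  have p: "p = g * r" using g by (simp add: r_def)
  have cop: "coprime (int k') (int r)"
    using g gpos k' p by (metis coprime_int_iff gcd_mult_distrib_nat nat_mult_eq_cancel_disj
        coprime_iff_gcd_eq_1 mult.right_neutral neq0_conv)
  \<comment> \<open>Cancelling g leaves the factor k/g, which is invertible mod r. This gives both
    disjointness of the classes and the freedom to reduce a coefficient mod r.\<close>
  have eq: "[y * int k = y' * int k] (mod int p) \<longleftrightarrow> [y = y'] (mod int r)" for y y'
  proof -
    have "[y * int k = y' * int k] (mod int p) \<longleftrightarrow> int g * int r dvd int g * ((y - y') * int k')"
      by (simp add: cong_iff_dvd_diff k' p algebra_simps)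
    also have "\<dots> \<longleftrightarrow> int r dvd (y - y') * int k'"
      using gpos by simp
    also have "\<dots> \<longleftrightarrow> int r dvd y - y'"
      using cop by (simp add: coprime_dvd_mult_left_iff coprime_commute)
    finally show ?thesis by (simp add: cong_iff_dvd_diff)
  qed
  have rpos: "r > 0" using \<open>p > 0\<close> p by simp
  have dis: "residue_class n p (x + int (s * k)) \<inter> residue_class n p (x + int (s' * k)) = {}"
    if "s < r" "s' < r" "s \<noteq> s'" for s s'
  proof (rule ccontr)
    assume "residue_class n p (x + int (s * k)) \<inter> residue_class n p (x + int (s' * k)) \<noteq> {}"
    then have "[x + int (s * k) = x + int (s' * k)] (mod int p)"
      by (auto simp: residue_class_def cong_def)
    then have "[int s = int s'] (mod int r)"
      using eq[of "int s" "int s'"] by (simp add: cong_add_lcancel)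
    with that show False by (simp add: cong_int_iff cong_def)
  qed
  have "residue_class n g x = (\<Union>s\<in>{..<r}. residue_class n p (x + int (s * k)))"
  proof (intro equalityI subsetI)
    fix v assume v: "v \<in> residue_class n g x"
    then have "int g dvd v - x" by (simp add: residue_class_def mod_eq_dvd_iff)
    then have "gcd (int k) (int p) dvd v - x" by (simp add: g)
    then obtain y where y: "[int k * y = v - x] (mod int p)"
      using cong_solve_dvd_int by blast
    define s where "s = nat (y mod int r)"
    have s: "s < r" "int s = y mod int r"
      using rpos by (simp_all add: s_def nat_less_iff)
    have "[int s * int k = y * int k] (mod int p)"
      unfolding eq by (simp add: s cong_def)
    with y have "[int s * int k = v - x] (mod int p)"
      by (simp add: mult.commute cong_trans)
    then have "[x + int s * int k = x + (v - x)] (mod int p)"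
      by (simp only: cong_add_lcancel)
    with v s show "v \<in> (\<Union>s\<in>{..<r}. residue_class n p (x + int (s * k)))"
      by (auto simp: residue_class_def cong_def intro!: bexI[of _ s])
  next
    fix v assume "v \<in> (\<Union>s\<in>{..<r}. residue_class n p (x + int (s * k)))"
    then obtain s where v: "v \<in> {0..<int n}" and "[v = x + int (s * k)] (mod int p)"
      by (auto simp: residue_class_def cong_def)
    then have "[v = x + int (s * k)] (mod int g)"
      using p by (auto intro: cong_dvd_modulus)
    moreover have "[x + int (s * k) = x] (mod int g)"
      by (simp add: cong_iff_dvd_diff k')
    ultimately have "[v = x] (mod int g)" by (rule cong_trans)
    with v show "v \<in> residue_class n g x" by (simp add: residue_class_def cong_def)
  qed
  then show ?thesis
    unfolding r_def[symmetric] using dis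
    by (simp add: sum.UNION_disjoint)
qed

lemma card_residue_class:
  assumes "n > 0" "g dvd n"
  shows "real (card (residue_class n g x)) = real n / real g"
proof -
  have "real (card (residue_class n g x)) = (\<Sum>v\<in>residue_class n g x. 1)" by simp
  also have "\<dots> = (\<Sum>s<n div g. 1)"
    \<comment> \<open>With k = g and p = n the class splits into n/g singletons.\<close>
    using sum_residue_class_refine[of n g g "\<lambda>_. 1" n x] assms
    by (simp add: residue_class_modulus gcd_nat.absorb1)
  finally show ?thesis using assms by (simp add: real_of_nat_div)
qed

section \<open>Variation of class sums around a cycle\<close>

lemma cyclic_variation_ge:
  fixes t w :: "nat \<Rightarrow> real"
  assumes step: "\<And>s. \<bar>t s - t (Suc s)\<bar> \<le> w s" and cyc: "t r = t 0" and "a < r" "b < r"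
  shows "2 * (t a - t b) \<le> (\<Sum>s<r. w s)"
proof -
  have path: "t a - t b \<le> (\<Sum>s\<in>{a..<b}. w s) \<and> t b - t a \<le> (\<Sum>s\<in>{a..<b}. w s)"
    if "a \<le> b" for a b
    using that
  proof (induction b rule: dec_induct)
    case (step b)
    then show ?case using assms(1)[of b] by (auto simp: sum.atLeastLessThan_Suc)
  qed simp
  have main: "2 * (t a - t b) \<le> (\<Sum>s<r. w s) \<and> 2 * (t b - t a) \<le> (\<Sum>s<r. w s)"
    if "a \<le> b" "b < r" for a b
  proof -
    \<comment> \<open>The points a and b split the cycle into two arcs, one of which wraps around
      through \<open>t r = t 0\<close>. Each arc carries at least the difference of the two values,
      hence the factor 2.\<close>
    have "(\<Sum>s<r. w s) = (\<Sum>s\<in>{0..<a}. w s) + (\<Sum>s\<in>{a..<b}. w s) + (\<Sum>s\<in>{b..<r}. w s)"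
      using that by (simp add: sum.atLeastLessThan_concat lessThan_atLeast0)
    with path[of 0 a] path[of a b] path[of b r] that cyc show ?thesis by auto
  qed
  show ?thesis using main[of a b] main[of b a] assms(3,4) by (cases "a \<le> b") auto
qed

text \<open>Translation by k carries each class mod p of the cycle onto the next one, so by the
  triangle inequality consecutive class sums differ by at most the variation of \<open>f\<close> on
  the first of the two.\<close>

lemma class_variation_ge:
  fixes f :: "int \<Rightarrow> real"
  assumes "n > 0" "p dvd n" and g: "g = gcd k p" and per: "\<And>v. f (v mod int n) = f v"
    and "a < p div g" "b < p div g"
  shows "2 * ((\<Sum>v\<in>residue_class n p (x + int (a * k)). f v) -
              (\<Sum>v\<in>residue_class n p (x + int (b * k)). f v))
         \<le> (\<Sum>v\<in>residue_class n g x. \<bar>f v - f (v + int k)\<bar>)"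
proof -
  have ppos: "p > 0" using assms(1,2) by (cases "p = 0") auto
  define t where "t s = (\<Sum>v\<in>residue_class n p (x + int (s * k)). f v)" for s
  define w where "w s = (\<Sum>v\<in>residue_class n p (x + int (s * k)). \<bar>f v - f (v + int k)\<bar>)" for s
  have "\<bar>t s - t (Suc s)\<bar> \<le> w s" for s
  proof -
    have "t (Suc s) = (\<Sum>v\<in>residue_class n p (x + int (s * k)). f (v + int k))"
      unfolding t_def
      by (subst sum_residue_class_shift) (use assms in \<open>simp_all add: algebra_simps\<close>)
    then show ?thesis
      unfolding t_def w_def by (simp add: sum_subtractf[symmetric] sum_abs)
  qed
  moreover have "t (p div g) = t 0"
  proof -
    \<comment> \<open>After p/g translations the cycle closes up.\<close>
    have "int p dvd int (p div g * k)"
      using g by (metis div_mult_swap dvd_triv_left gcd_dvd1 gcd_dvd2 int_dvd_int_iff mult.commute)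
    then have "(x + int (p div g * k)) mod int p = x mod int p"
      by (metis add.right_neutral dvd_eq_mod_eq_0 mod_add_right_eq)
    then have "residue_class n p (x + int (p div g * k)) = residue_class n p x"
      by (rule residue_class_cong)
    then show ?thesis unfolding t_def by simp
  qed
  ultimately have "2 * (t a - t b) \<le> (\<Sum>s<p div g. w s)"
    using assms(5,6) by (intro cyclic_variation_ge) auto
  also have "\<dots> = (\<Sum>v\<in>residue_class n g x. \<bar>f v - f (v + int k)\<bar>)"
    unfolding w_def using sum_residue_class_refine[OF ppos g] by simp
  finally show ?thesis by (simp add: t_def)
qed

text \<open>Up to the factor \<open>1 / n\<close>, the weight that the first \<open>i\<close> stripes contribute to the cut of \<open>f\<close>
  inside the class of \<open>x\<close> mod \<open>g\<^sub>i\<close>, without the extra weight of stripe \<open>\<ell>\<close>.\<close>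

definition layered_cut :: "nat \<Rightarrow> (nat \<Rightarrow> nat) \<Rightarrow> (int \<Rightarrow> real) \<Rightarrow> nat \<Rightarrow> int \<Rightarrow> real" where
  "layered_cut n \<phi> f i x = (\<Sum>j = 1..i. (real (g_seq n \<phi> (j - 1)) - real (g_seq n \<phi> j)) *
     (\<Sum>v\<in>residue_class n (g_seq n \<phi> i) x. \<bar>f v - f (v + int (\<phi> j))\<bar>))"

section \<open>Recursion and lower bounds for layered cuts\<close>

lemma g_seq_dvd_n: "g_seq n \<phi> i dvd n"
  by (induction i) (auto intro: dvd_trans)

lemma g_seq_pos: "n > 0 \<Longrightarrow> g_seq n \<phi> i > 0"
  using g_seq_dvd_n[of n \<phi> i] by (cases "g_seq n \<phi> i = 0") auto

lemma layered_cut_Suc: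
  assumes "n > 0"
  shows "layered_cut n \<phi> f (Suc i) x =
    (\<Sum>s<g_seq n \<phi> i div g_seq n \<phi> (Suc i). layered_cut n \<phi> f i (x + int (s * \<phi> (Suc i)))) +
    (real (g_seq n \<phi> i) - real (g_seq n \<phi> (Suc i))) *
    (\<Sum>v\<in>residue_class n (g_seq n \<phi> (Suc i)) x. \<bar>f v - f (v + int (\<phi> (Suc i)))\<bar>)"
proof -
  have r: "(\<Sum>v\<in>residue_class n (g_seq n \<phi> (Suc i)) x. F v) =
     (\<Sum>s<g_seq n \<phi> i div g_seq n \<phi> (Suc i). \<Sum>v\<in>residue_class n (g_seq n \<phi> i) (x + int (s * \<phi> (Suc i))). F v)"
    for F :: "int \<Rightarrow> real"
    by (rule sum_residue_class_refine) (use g_seq_pos[OF assms] in auto)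
  have "(\<Sum>j = 1..i. (real (g_seq n \<phi> (j - 1)) - real (g_seq n \<phi> j)) *
     (\<Sum>v\<in>residue_class n (g_seq n \<phi> (Suc i)) x. \<bar>f v - f (v + int (\<phi> j))\<bar>)) =
     (\<Sum>s<g_seq n \<phi> i div g_seq n \<phi> (Suc i). layered_cut n \<phi> f i (x + int (s * \<phi> (Suc i))))"
    unfolding r layered_cut_def sum_distrib_left by (rule sum.swap)
  then show ?thesis unfolding layered_cut_def by simp
qed

lemma layered_cut_nonneg: "n > 0 \<Longrightarrow> layered_cut n \<phi> f i x \<ge> 0"
  unfolding layered_cut_def
proof (intro sum_nonneg mult_nonneg_nonneg)
  fix j assume "n > 0" "j \<in> {1..i}"
  then show "0 \<le> real (g_seq n \<phi> (j - 1)) - real (g_seq n \<phi> j)"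
    using g_seq_pos[of n \<phi> "j - 1"] by (cases j) (auto intro: gcd_le2_nat)
qed auto

lemma layered_cut_complement: "layered_cut n \<phi> (\<lambda>v. 1 - f v) i x = layered_cut n \<phi> f i x"
  by (simp add: layered_cut_def abs_minus_commute)

lemma sum_residue_class_complement:
  assumes "n > 0" "g dvd n"
  shows "(\<Sum>v\<in>residue_class n g x. 1 - f v) = real n / real g - (\<Sum>v\<in>residue_class n g x. f v)"
  using card_residue_class[OF assms, of x] by (simp add: sum_subtractf)

lemma sum_residue_class_bounds:
  fixes f :: "int \<Rightarrow> real"
  assumes "n > 0" "g dvd n" "\<And>v. f v \<in> {0, 1}"
  shows "0 \<le> (\<Sum>v\<in>residue_class n g x. f v)" "real g * (\<Sum>v\<in>residue_class n g x. f v) \<le> real n"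
proof -
  have f: "0 \<le> f v" "f v \<le> 1" for v using assms(3)[of v] by auto
  show "0 \<le> (\<Sum>v\<in>residue_class n g x. f v)" by (simp add: f sum_nonneg)
  have "(\<Sum>v\<in>residue_class n g x. f v) \<le> real n / real g"
    unfolding card_residue_class[OF assms(1,2), of x, symmetric]
    using sum_mono[of "residue_class n g x" f "\<lambda>_. 1"] f by simp
  then show "real g * (\<Sum>v\<in>residue_class n g x. f v) \<le> real n"
    using assms(1,2) by (cases "g = 0") (auto simp: field_simps)
qed

text \<open>The bound is 0 when the class is full, as it has n/g_i elements. In the induction step
  either some class of the cycle misses the set and the variation along the new stripe compensates,
  or all of them meet it and the inductive bounds add up.\<close>

lemma layered_cut_ge:
  fixes f :: "int \<Rightarrow> real"
  assumes "n > 0" and f01: "\<And>v. f v \<in> {0, 1}" and per: "\<And>v. f (v mod int n) = f v"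
    and "(\<Sum>v\<in>residue_class n (g_seq n \<phi> i) x. f v) > 0"
  shows "layered_cut n \<phi> f i x \<ge>
    2 * real n - 2 * real (g_seq n \<phi> i) * (\<Sum>v\<in>residue_class n (g_seq n \<phi> i) x. f v)"
  using assms(4)
proof (induction i arbitrary: x)
  case 0
  \<comment> \<open>A class mod n is a single residue, so its sum is 1 and the bound reads 0 \<ge>
    0.\<close>
  then have "f (x mod int n) = 1"
    using f01[of "x mod int n"] assms(1) by (auto simp: residue_class_modulus)
  then show ?case using assms(1) by (simp add: residue_class_modulus layered_cut_def)
next
  case (Suc i)
  define p g k where "p = g_seq n \<phi> i" and "g = g_seq n \<phi> (Suc i)" and "k = \<phi> (Suc i)"
  define r where "r = p div g"
  define t where "t s = (\<Sum>v\<in>residue_class n p (x + int (s * k)). f v)" for s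
  define B where "B s = layered_cut n \<phi> f i (x + int (s * k))" for s
  define N where "N = (\<Sum>v\<in>residue_class n g x. \<bar>f v - f (v + int k)\<bar>)"
  define T where "T = (\<Sum>v\<in>residue_class n g x. f v)"
  have gk: "g = gcd k p" by (simp add: g_def k_def p_def)
  have pos: "p > 0" "g > 0" using g_seq_pos[OF assms(1)] by (simp_all add: p_def g_def)
  have dvd: "p dvd n" "g dvd n" by (simp_all add: p_def g_def g_seq_dvd_n del: g_seq.simps)
  have pr: "real p = real g * real r"
    using gk unfolding r_def by (metis dvd_mult_div_cancel gcd_dvd2 of_nat_mult)
  have r: "r \<ge> 1" using pr pos by (cases r) auto
  have cut: "layered_cut n \<phi> f (Suc i) x = (\<Sum>s<r. B s) + (real p - real g) * N"
    unfolding B_def N_def r_def p_def g_def k_def by (rule layered_cut_Suc[OF assms(1)])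
  have Tsum: "T = (\<Sum>s<r. t s)"
    unfolding T_def t_def r_def by (rule sum_residue_class_refine[OF pos(1) gk])
  have IH: "B s \<ge> 2 * real n - 2 * real p * t s" if "t s > 0" for s
    using Suc.IH[of "x + int (s * k)"] that by (simp add: B_def t_def p_def)
  have B0: "B s \<ge> 0" for s unfolding B_def by (rule layered_cut_nonneg[OF assms(1)])
  have t0: "t s \<ge> 0" for s
    unfolding t_def by (rule sum_residue_class_bounds[OF assms(1) dvd(1) f01])
  have pg: "real p - real g \<ge> 0" using pr r pos by (simp add: mult_le_cancel_left1)
  have "T > 0" using Suc.prems by (simp add: T_def g_def)
  have goal: "(\<Sum>s<r. B s) + (real p - real g) * N \<ge> 2 * real n - 2 * real g * T"
  proof (cases "\<exists>b<r. t b = 0")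
    case True
    then obtain b where b: "b < r" "t b = 0" by blast
    obtain a where a: "a < r" "t a > 0"
    proof (rule ccontr)
      assume "\<not> thesis"
      with that have "\<forall>a<r. t a \<le> 0" by force
      then have "T \<le> 0" unfolding Tsum by (intro sum_nonpos) auto
      with \<open>T > 0\<close> show False by simp
    qed
    \<comment> \<open>Class a falls short of 2n by at most 2 p t_a; the new stripe returns 2 (p - g)
      t_a, leaving a loss of 2 g t_a, which is at most 2 g T.\<close>
    have "2 * t a \<le> N"
      using class_variation_ge[where f = f and n = n and x = x and a = a and b = b, OF assms(1) dvd(1) gk per] a b
      by (simp add: t_def N_def r_def)
    then have "(real p - real g) * (2 * t a) \<le> (real p - real g) * N"
      using pg by (rule mult_left_mono)
    moreover have "(\<Sum>s<r. B s) \<ge> B a"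
      using a B0 by (intro member_le_sum) auto
    moreover have "real g * t a \<le> real g * T"
      unfolding Tsum using a t0 by (intro mult_left_mono member_le_sum) auto
    ultimately show ?thesis using IH[OF a(2)] by (simp add: algebra_simps)
  next
    case False
    then have "(\<Sum>s<r. B s) \<ge> (\<Sum>s<r. 2 * real n - 2 * real p * t s)"
      using t0 by (intro sum_mono IH) (auto simp: order.strict_iff_order)
    \<comment> \<open>As p = g r, the inductive bounds sum to r copies of the desired one; a single
      copy suffices because g T \<le> n makes it nonnegative.\<close>
    also have "(\<Sum>s<r. 2 * real n - 2 * real p * t s) = real r * (2 * real n - 2 * real g * T)"
      unfolding Tsum by (simp add: sum_subtractf sum_distrib_left pr algebra_simps)
    finally have "(\<Sum>s<r. B s) \<ge> real r * (2 * real n - 2 * real g * T)" .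
    moreover have "2 * real n - 2 * real g * T \<ge> 0"
      using sum_residue_class_bounds(2)[where f = f and x = x, OF assms(1) dvd(2) f01] unfolding T_def by simp
    then have "real r * (2 * real n - 2 * real g * T) \<ge> 1 * (2 * real n - 2 * real g * T)"
      using r by (intro mult_right_mono) auto
    moreover have "N \<ge> 0" unfolding N_def by (intro sum_nonneg) auto
    then have "(real p - real g) * N \<ge> 0" using pg by simp
    ultimately show ?thesis by simp
  qed
  show ?case using goal unfolding cut by (simp add: T_def g_def)
qed

text \<open>The extra weight raises the coefficient of N from p - 1 to p. If some class mod p misses
  the set or its complement, p N repays the whole loss 2 p t_a. Otherwise each class contributes at
  least n, and there are at least two classes.\<close>

lemma layered_cut_top:
  fixes f :: "int \<Rightarrow> real"
  assumes "n > 0" and f01: "\<And>v. f v \<in> {0, 1}" and per: "\<And>v. f (v mod int n) = f v"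
    and top: "g_seq n \<phi> (Suc i) = 1" and "g_seq n \<phi> i \<noteq> 1"
    and nonempty: "a \<in> {0..<int n}" "f a = 1" and proper: "b \<in> {0..<int n}" "f b = 0"
  shows "layered_cut n \<phi> f (Suc i) 0 + (\<Sum>v\<in>{0..<int n}. \<bar>f v - f (v + int (\<phi> (Suc i)))\<bar>) \<ge> 2 * real n"
proof -
  define p k where "p = g_seq n \<phi> i" and "k = \<phi> (Suc i)"
  define B where "B s = layered_cut n \<phi> f i (int (s * k))" for s
  define N where "N = (\<Sum>v\<in>{0..<int n}. \<bar>f v - f (v + int k)\<bar>)"
  have gk: "1 = gcd k p" using top by (simp add: k_def p_def)
  have p: "p \<ge> 2" using g_seq_pos[OF assms(1), of \<phi> i] assms(5) by (simp add: p_def)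
  have dvd: "p dvd n" by (simp add: p_def g_seq_dvd_n)
  have cut: "layered_cut n \<phi> f (Suc i) 0 = (\<Sum>s<p. B s) + (real p - 1) * N"
    using layered_cut_Suc[OF assms(1), of \<phi> f i 0] top
    by (simp add: B_def N_def p_def k_def residue_class_Suc_0 del: g_seq.simps)
  have B0: "B s \<ge> 0" for s unfolding B_def by (rule layered_cut_nonneg[OF assms(1)])
  \<comment> \<open>Stated for any 0/1 function whose cuts are those of \<open>f\<close>, so that it also applies to \<open>1 - f\<close>.\<close>
  have empty: "(\<Sum>s<p. B s) + real p * N \<ge> 2 * real n"
    if h01: "\<And>v. h v \<in> {0, 1}" and perh: "\<And>v. h (v mod int n) = h v"
      and hB: "\<And>s. layered_cut n \<phi> h i (int (s * k)) = B s"
      and hN: "(\<Sum>v\<in>{0..<int n}. \<bar>h v - h (v + int k)\<bar>) = N"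
      and c: "c \<in> {0..<int n}" "h c = 1"
      and d: "d < p" "(\<Sum>v\<in>residue_class n p (int (d * k)). h v) = 0"
    for h :: "int \<Rightarrow> real" and c d
  proof -
    define t where "t s = (\<Sum>v\<in>residue_class n p (int (s * k)). h v)" for s
    have hpos: "h v \<ge> 0" for v using h01[of v] by auto
    obtain a where a: "a < p" "t a > 0"
    proof (rule ccontr)
      assume "\<not> thesis"
      with that have "\<forall>a<p. t a \<le> 0" by force
      then have "(\<Sum>s<p. t s) \<le> 0" by (intro sum_nonpos) auto
      also have "(\<Sum>s<p. t s) = (\<Sum>v\<in>{0..<int n}. h v)"
        using sum_residue_class_refine[of p 1 k h n 0] gk p
        by (simp add: t_def residue_class_Suc_0)
      finally have "(\<Sum>v\<in>{0..<int n}. h v) \<le> 0" .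
      moreover have "h c \<le> (\<Sum>v\<in>{0..<int n}. h v)" using c hpos by (intro member_le_sum) auto
      ultimately show False using c by simp
    qed
    have "2 * t a \<le> N"
      using class_variation_ge[where f = h and n = n and x = 0 and a = a and b = d, OF assms(1) dvd gk perh] a d hN
      by (simp add: t_def residue_class_Suc_0)
    then have "real p * (2 * t a) \<le> real p * N" by (rule mult_left_mono) simp
    moreover have "(\<Sum>s<p. B s) \<ge> B a" using a B0 by (intro member_le_sum) auto
    moreover have "B a \<ge> 2 * real n - 2 * real p * t a"
      using layered_cut_ge[where f = h and \<phi> = \<phi> and i = i and x = "int (a * k)", OF assms(1) h01 perh] a hB[of a]
      by (simp add: t_def p_def)
    ultimately show ?thesis by simp
  qed
  define f' where "f' v = 1 - f v" for v
  define t where "t s = (\<Sum>v\<in>residue_class n p (int (s * k)). f v)" for s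
  define t' where "t' s = (\<Sum>v\<in>residue_class n p (int (s * k)). f' v)" for s
  have f': "f' v \<in> {0, 1}" for v using f01[of v] by (auto simp: f'_def)
  have per': "f' (v mod int n) = f' v" for v by (simp add: f'_def per)
  have B': "layered_cut n \<phi> f' i (int (s * k)) = B s" for s
    unfolding f'_def B_def by (rule layered_cut_complement)
  have N': "(\<Sum>v\<in>{0..<int n}. \<bar>f' v - f' (v + int k)\<bar>) = N"
    unfolding f'_def N_def by (simp add: abs_minus_commute)
  have "(\<Sum>s<p. B s) + real p * N \<ge> 2 * real n"
  proof (cases "\<exists>d<p. t d = 0 \<or> t' d = 0")
    case True
    then obtain d where d: "d < p" "t d = 0 \<or> t' d = 0" by blast
    from d(2) show ?thesis
    proof
      assume "t d = 0"
      show ?thesis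
        by (rule empty[OF f01 per _ _ nonempty d(1)])
           (use \<open>t d = 0\<close> in \<open>simp_all only: t_def B_def N_def\<close>)
    next
      assume "t' d = 0"
      have "f' b = 1" using proper by (simp add: f'_def)
      show ?thesis
        by (rule empty[OF f' per' B' N' proper(1) \<open>f' b = 1\<close> d(1)])
           (use \<open>t' d = 0\<close> in \<open>simp only: t'_def\<close>)
    qed
  next
    case False
    have "B s \<ge> real n" if "s < p" for s
    proof -
      have t: "t s > 0" "t' s > 0"
        using False that sum_residue_class_bounds(1)[where f = f and x = "int (s * k)", OF assms(1) dvd f01]
          sum_residue_class_bounds(1)[where f = f' and x = "int (s * k)", OF assms(1) dvd f']
        by (auto simp: t_def t'_def order.strict_iff_order)
      have "B s \<ge> 2 * real n - 2 * real p * t s"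
        using layered_cut_ge[where f = f and \<phi> = \<phi> and i = i and x = "int (s * k)", OF assms(1) f01 per] t by (simp add: t_def p_def B_def)
      moreover have "B s \<ge> 2 * real n - 2 * real p * t' s"
        using layered_cut_ge[where f = f' and \<phi> = \<phi> and i = i and x = "int (s * k)", OF assms(1) f' per'] t B' by (simp add: t'_def p_def)
      moreover have "real p * t s + real p * t' s = real n"
        using sum_residue_class_complement[OF assms(1) dvd, of f "int (s * k)"] p
        by (simp add: t_def t'_def f'_def field_simps)
      \<comment> \<open>The two lower bounds for \<open>B s\<close> have average n.\<close>
      ultimately show ?thesis by linarith
    qed
    then have "(\<Sum>s<p. B s) \<ge> (\<Sum>s<p. real n)" by (intro sum_mono) auto
    moreover have "real p * real n \<ge> 2 * real n" using p by (intro mult_right_mono) auto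
    moreover have "N \<ge> 0" unfolding N_def by (intro sum_nonneg) auto
    then have "real p * N \<ge> 0" by simp
    ultimately show ?thesis by simp
  qed
  then show ?thesis unfolding cut by (simp add: N_def k_def algebra_simps)
qed

section \<open>Edges as translates\<close>

text \<open>The vertex in \<open>{1..n}\<close> congruent to \<open>v\<close> mod \<open>n\<close>.\<close>

definition vert :: "nat \<Rightarrow> int \<Rightarrow> nat" where
  "vert n v = nat ((v - 1) mod int n) + 1"

definition circ_edge :: "nat \<Rightarrow> nat \<Rightarrow> int \<Rightarrow> nat set" where
  "circ_edge n k v = {vert n v, vert n (v + int k)}"

lemma int_vert: "n > 0 \<Longrightarrow> int (vert n v) = (v - 1) mod int n + 1"
  by (simp add: vert_def)

lemma vert_in_vertices: "n > 0 \<Longrightarrow> vert n v \<in> vertices n"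
proof -
  assume n: "n > 0"
  then have "0 \<le> (v - 1) mod int n" "(v - 1) mod int n < int n" by simp_all
  then have "1 \<le> int (vert n v)" "int (vert n v) \<le> int n"
    unfolding int_vert[OF n] by linarith+
  then show ?thesis by (simp add: vertices_def)
qed

lemma vert_mod_eq: "n > 0 \<Longrightarrow> int (vert n v) mod int n = v mod int n"
  by (simp add: int_vert mod_simps)

lemma vert_eq_iff: "n > 0 \<Longrightarrow> vert n v = vert n w \<longleftrightarrow> v mod int n = w mod int n"
proof
  assume n: "n > 0"
  show "v mod int n = w mod int n" if "vert n v = vert n w"
    using vert_mod_eq[OF n, of v] vert_mod_eq[OF n, of w] that by simp
  show "vert n v = vert n w" if "v mod int n = w mod int n"
    unfolding vert_def using mod_diff_cong[OF that refl, of 1] by simp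
qed

lemma vert_mod [simp]: "n > 0 \<Longrightarrow> vert n (v mod int n) = vert n v"
  by (simp add: vert_eq_iff)

lemma vert_of_nat: "i \<in> vertices n \<Longrightarrow> vert n (int i) = i"
  by (auto simp: vert_def vertices_def nat_mod_distrib)

lemma vert_eq_iff_less:
  "v \<in> {0..<int n} \<Longrightarrow> w \<in> {0..<int n} \<Longrightarrow> vert n v = vert n w \<longleftrightarrow> v = w"
  by (subst vert_eq_iff) auto

lemma vert_add_neq:
  assumes "n > 0" "0 < k" "k < n"
  shows "vert n v \<noteq> vert n (v + int k)"
proof
  assume "vert n v = vert n (v + int k)"
  then have "int n dvd int k"
    using assms by (simp add: vert_eq_iff mod_eq_dvd_iff)
  then show False using assms by (auto dest: dvd_imp_le)
qed

lemma circ_dist_mod: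
  "circ_dist n (vert n v) (vert n w) = nat (min ((v - w) mod int n) ((w - v) mod int n))" if "n > 0"
proof -
  have "(int (vert n v) - int (vert n w)) mod int n = (v - w) mod int n" for v w
    by (intro mod_diff_cong) (simp_all add: vert_mod_eq that)
  then show ?thesis by (simp add: circ_dist_def)
qed

lemma stripe_eq_image:
  assumes k: "0 < k" "2 * k \<le> n"
  shows "stripe n k = circ_edge n k ` {0..<int n}"
proof (intro equalityI subsetI)
  have n: "n > 0" "k < n" using k by auto
  { fix e assume "e \<in> circ_edge n k ` {0..<int n}"
    then obtain v where e: "e = {vert n v, vert n (v + int k)}" by (auto simp: circ_edge_def)
    have "e \<in> edges n"
      unfolding e edges_def using vert_in_vertices[OF n(1)] vert_add_neq[OF n(1) k(1) n(2)] by auto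
    \<comment> \<open>Since 2k \<le> n, the opposite residue n - k is not below k, so the minimum is
      k.\<close>
    moreover have "(- int k) mod int n = int n - int k" "int k mod int n = int k"
      using k n by (simp_all add: zmod_zminus1_eq_if)
    then have "circ_dist n (vert n v) (vert n (v + int k)) = k"
      using k by (simp add: circ_dist_mod[OF n(1)])
    ultimately show "e \<in> stripe n k" unfolding stripe_def e by blast }
  { fix e assume "e \<in> stripe n k"
    then obtain i j where e: "e = {i, j}" "{i, j} \<in> edges n" and d: "circ_dist n i j = k"
      by (auto simp: stripe_def)
    have main: "{i, j} \<in> circ_edge n k ` {0..<int n}"
      if ij: "i \<in> vertices n" "j \<in> vertices n" and "(int j - int i) mod int n = int k" for i j
    proof -
      have "(int i mod int n + int k) mod int n = (int i + (int j - int i)) mod int n"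
        unfolding that(3)[symmetric] by (simp only: mod_simps)
      then have "vert n (int i mod int n + int k) = j"
        using n ij by (metis vert_mod vert_of_nat add_diff_cancel_left' add_diff_eq)
      then have "{i, j} = circ_edge n k (int i mod int n)"
        using n ij by (simp add: circ_edge_def vert_of_nat)
      then show ?thesis using n by auto
    qed
    have ij: "i \<in> vertices n" "j \<in> vertices n" using e(2) by (auto simp: edges_def)
    have "(int i - int j) mod int n = int k \<or> (int j - int i) mod int n = int k"
      using d n unfolding circ_dist_def by (auto simp: min_def split: if_splits)
    then show "e \<in> circ_edge n k ` {0..<int n}"
      using main[of i j] main[of j i] ij e by (auto simp: insert_commute) }
qed

section \<open>Decomposition of edge sums into stripes\<close>

lemma edges_eq_stripes:
  assumes "n > 0"
  shows "edges n = (\<Union>k\<in>{1..n div 2}. stripe n k)"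
proof (intro equalityI subsetI)
  fix e assume e: "e \<in> edges n"
  then obtain i j where ij: "e = {i, j}" "i \<noteq> j" by (auto simp: edges_def card_2_iff)
  have V: "i \<in> vertices n" "j \<in> vertices n" using e ij by (auto simp: edges_def)
  define a where "a = (int i - int j) mod int n"
  have a: "0 \<le> a" "a < int n" using assms by (simp_all add: a_def)
  have "a \<noteq> 0"
  proof
    assume "a = 0"
    then have "int i mod int n = int j mod int n"
      by (simp add: a_def mod_eq_dvd_iff dvd_eq_mod_eq_0)
    then have "vert n (int i) = vert n (int j)" using assms by (simp add: vert_eq_iff)
    with V ij show False by (simp add: vert_of_nat)
  qed
  \<comment> \<open>The two nonzero residues add up to n, so the smaller one is at most n/2.\<close>
  have "(int j - int i) mod int n = int n - a"
    using zmod_zminus1_eq_if[of "int i - int j" "int n"] \<open>a \<noteq> 0\<close> by (simp add: a_def)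
  then have "circ_dist n i j = nat (min a (int n - a))"
    by (simp add: circ_dist_def a_def)
  then have "circ_dist n i j \<in> {1..n div 2}" using a \<open>a \<noteq> 0\<close> by auto
  moreover have "e \<in> stripe n (circ_dist n i j)" using e ij by (auto simp: stripe_def)
  ultimately show "e \<in> (\<Union>k\<in>{1..n div 2}. stripe n k)" by blast
qed (auto simp: stripe_def)

lemma finite_edges [simp]: "finite (edges n)"
  by (rule finite_subset[of _ "Pow {1..n}"]) (auto simp: edges_def vertices_def)

lemma stripe_subset_edges: "stripe n k \<subseteq> edges n"
  by (auto simp: stripe_def)

lemma finite_stripe [simp]: "finite (stripe n k)"
  using finite_subset[OF stripe_subset_edges] by simp

lemma sum_edges:
  fixes F :: "nat set \<Rightarrow> real"
  assumes "n > 0" "\<phi> permutes {1..n div 2}"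
  shows "(\<Sum>e\<in>edges n. F e) = (\<Sum>i = 1..n div 2. \<Sum>e\<in>stripe n (\<phi> i). F e)"
proof -
  have "(\<Sum>e\<in>edges n. F e) = (\<Sum>k = 1..n div 2. \<Sum>e\<in>stripe n k. F e)"
    unfolding edges_eq_stripes[OF assms(1)]
    by (rule sum.UNION_disjoint) (auto dest: edge_length_stripe)
  also have "\<dots> = (\<Sum>i = 1..n div 2. \<Sum>e\<in>stripe n (\<phi> i). F e)"
    using sum.permute[OF assms(2), of "\<lambda>k. \<Sum>e\<in>stripe n k. F e"] by (simp add: o_def)
  finally show ?thesis .
qed

text \<open>The edges of length \<open>n/2\<close> arise from two starting points each.\<close>

lemma sum_stripe:
  fixes F :: "nat set \<Rightarrow> real"
  assumes k: "0 < k" "2 * k \<le> n"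
  shows "(\<Sum>e\<in>stripe n k. F e) = (if 2 * k = n then 1 / 2 else 1) * (\<Sum>v\<in>{0..<int n}. F (circ_edge n k v))"
proof (cases "2 * k = n")
  case False
  have "inj_on (circ_edge n k) {0..<int n}"
  proof (rule inj_onI)
    fix v w assume vw: "v \<in> {0..<int n}" "w \<in> {0..<int n}" "circ_edge n k v = circ_edge n k w"
    \<comment> \<open>Equal edges with swapped ends would make n divide 2k, although 0 < 2k <
      n.\<close>
    have "\<not> (vert n v = vert n (w + int k) \<and> vert n (v + int k) = vert n w)"
    proof
      assume "vert n v = vert n (w + int k) \<and> vert n (v + int k) = vert n w"
      then have "int n dvd v - (w + int k)" "int n dvd v + int k - w"
        using k by (simp_all add: vert_eq_iff mod_eq_dvd_iff)
      then have "int n dvd v + int k - w - (v - (w + int k))" by (rule dvd_diff[rotated])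
      then have "int n dvd int (2 * k)" by (simp add: algebra_simps)
      then show False using k False by (auto dest: dvd_imp_le simp del: of_nat_mult)
    qed
    with vw have "vert n v = vert n w" by (auto simp: circ_edge_def doubleton_eq_iff)
    with vw show "v = w" by (simp add: vert_eq_iff_less)
  qed
  then show ?thesis using False by (simp add: stripe_eq_image[OF k] sum.reindex)
next
  case True
  \<comment> \<open>For 2k = n translation by k swaps the ends, so the first k starting points
    already give every edge once.\<close>
  have shift: "circ_edge n k (v + int k) = circ_edge n k v" for v
  proof -
    have "vert n (v + int k + int k) = vert n v"
      using True k by (simp add: vert_eq_iff flip: True)
    then show ?thesis by (simp add: circ_edge_def insert_commute)
  qed
  have split: "{0..<int n} = {0..<int k} \<union> {int k..<int n}" using True by auto
  have img: "{int k..<int n} = (\<lambda>v. v + int k) ` {0..<int k}"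
    using True by (simp add: image_add_atLeastLessThan' flip: True)
  have "stripe n k = circ_edge n k ` {0..<int k}"
    unfolding stripe_eq_image[OF k] split img image_Un image_image shift by simp
  moreover have "inj_on (circ_edge n k) {0..<int k}"
  proof (rule inj_onI)
    fix v w assume vw: "v \<in> {0..<int k}" "w \<in> {0..<int k}" "circ_edge n k v = circ_edge n k w"
    have "v \<in> {0..<int n}" "w \<in> {0..<int n}" "w + int k \<in> {0..<int n}" "v \<noteq> w + int k"
      using vw True by auto
    with vw(3) show "v = w"
      by (auto simp: circ_edge_def doubleton_eq_iff vert_eq_iff_less)
  qed
  ultimately have "(\<Sum>e\<in>stripe n k. F e) = (\<Sum>v\<in>{0..<int k}. F (circ_edge n k v))"
    by (simp add: sum.reindex)
  moreover have "(\<Sum>v\<in>{int k..<int n}. F (circ_edge n k v)) = (\<Sum>v\<in>{0..<int k}. F (circ_edge n k v))"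
    unfolding img by (subst sum.reindex) (auto simp: inj_on_def shift)
  moreover have "(\<Sum>v\<in>{0..<int n}. F (circ_edge n k v)) =
      (\<Sum>v\<in>{0..<int k}. F (circ_edge n k v)) + (\<Sum>v\<in>{int k..<int n}. F (circ_edge n k v))"
    unfolding split by (rule sum.union_disjoint) auto
  ultimately show ?thesis using True by simp
qed

section \<open>Feasibility of the stripe solution\<close>

lemma g_seq_mono: "n > 0 \<Longrightarrow> g_seq n \<phi> (Suc i) \<le> g_seq n \<phi> i"
  using g_seq_pos[of n \<phi> i] by (auto intro: gcd_le2_nat)

text \<open>Serves both the constraints and the objective: \<open>H\<close> becomes a cut indicator
  or the edge cost.\<close>

lemma sum_stripe_solution:
  fixes H :: "nat set \<Rightarrow> real"
  assumes "n \<ge> 2" and \<phi>: "\<phi> permutes {1..n div 2}"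
  shows "(\<Sum>e\<in>edges n. stripe_solution n \<phi> e * H e) =
    ((\<Sum>i = 1..ell n \<phi>. (real (g_seq n \<phi> (i - 1)) - real (g_seq n \<phi> i)) *
        (\<Sum>v\<in>{0..<int n}. H (circ_edge n (\<phi> i) v))) +
     (\<Sum>v\<in>{0..<int n}. H (circ_edge n (\<phi> (ell n \<phi>)) v))) / real n"
proof -
  define l where "l = ell n \<phi>"
  define h where "h i = (\<Sum>v\<in>{0..<int n}. H (circ_edge n (\<phi> i) v))" for i
  define D where "D i = real (g_seq n \<phi> (i - 1)) - real (g_seq n \<phi> i)" for i
  note l = ell_props[OF assms, folded l_def]
  have contrib: "(\<Sum>e\<in>stripe n (\<phi> i). stripe_solution n \<phi> e * H e) =
      (if i \<le> l then D i * h i / real n else 0) + (if i = l then h l / real n else 0)"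
    if "i \<in> {1..n div 2}" for i
  proof -
    have "\<phi> i \<in> {1..n div 2}" using permutes_in_image[OF \<phi>] that by blast
    then have k: "0 < \<phi> i" "2 * \<phi> i \<le> n" by auto
    have "(\<Sum>e\<in>stripe n (\<phi> i). stripe_solution n \<phi> e * H e) = (\<Sum>e\<in>stripe n (\<phi> i). stripe_weight n \<phi> i * H e)"
      by (intro sum.cong refl) (simp add: stripe_solution_stripe[OF \<phi>])
    also have "\<dots> = stripe_weight n \<phi> i * ((if 2 * \<phi> i = n then 1 / 2 else 1) * h i)"
      by (simp add: sum_stripe[OF k] h_def flip: sum_distrib_left)
    also have "\<dots> = (if i \<le> l then D i * h i / real n else 0) + (if i = l then h l / real n else 0)"
    proof -
      \<comment> \<open>The doubled weight at length n/2 cancels the factor 1/2 of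
        \<open>sum_stripe\<close>. Since g_l = 1, the weight g_(l-1) equals (g_(l-1) - g_l) + 1;
        this 1 is the source of the extra term.\<close>
      have "stripe_weight n \<phi> i * (if 2 * \<phi> i = n then 1 / 2 else 1) =
          ((if i \<le> l then D i else 0) + (if i = l then 1 else 0)) / real n"
        unfolding stripe_weight_def l_def[symmetric] D_def using l(3) by simp
      then have "stripe_weight n \<phi> i * (if 2 * \<phi> i = n then 1 / 2 else 1) * h i =
          ((if i \<le> l then D i else 0) + (if i = l then 1 else 0)) / real n * h i"
        by simp
      then show ?thesis by (simp add: algebra_simps add_divide_distrib)
    qed
    finally show ?thesis .
  qed
  have "(\<Sum>e\<in>edges n. stripe_solution n \<phi> e * H e) =
      (\<Sum>i = 1..n div 2. (if i \<le> l then D i * h i / real n else 0) + (if i = l then h l / real n else 0))"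
    using assms by (simp add: sum_edges[OF _ \<phi>] contrib)
  also have "\<dots> = (\<Sum>i = 1..n div 2. if i \<le> l then D i * h i / real n else 0) + h l / real n"
    using l by (simp add: sum.distrib)
  also have "(\<Sum>i = 1..n div 2. if i \<le> l then D i * h i / real n else 0) = (\<Sum>i = 1..l. D i * h i / real n)"
    using l by (intro sum.mono_neutral_cong_right) auto
  finally show ?thesis
    by (simp add: l_def h_def D_def add_divide_distrib sum_divide_distrib)
qed

section \<open>Degree, cut and box constraints\<close>

lemma cut_sum:
  "(\<Sum>e\<in>cut n S. x e) = (\<Sum>e\<in>edges n. x e * of_bool (card (e \<inter> S) = 1))" for x :: "nat set \<Rightarrow> real"
  unfolding cut_def by (rule sum.mono_neutral_cong_left) auto

lemma card_circ_edge_Int: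
  assumes "0 < k" "k < n"
  shows "of_bool (card (circ_edge n k v \<inter> S) = 1) =
    \<bar>of_bool (vert n v \<in> S) - of_bool (vert n (v + int k) \<in> S) :: real\<bar>"
proof -
  have "vert n v \<noteq> vert n (v + int k)" using assms by (intro vert_add_neq) auto
  then show ?thesis unfolding circ_edge_def by (auto simp: Int_insert_left)
qed

text \<open>This is the shape of \<open>layered_cut\<close> at level \<open>ell n \<phi>\<close>,
  where the only residue class is the whole vertex set, plus the extra variation treated in
  \<open>layered_cut_top\<close>.\<close>

lemma stripe_solution_cut:
  assumes "n \<ge> 3" and \<phi>: "\<phi> permutes {1..n div 2}"
  defines "f S v \<equiv> of_bool (vert n v \<in> S) :: real"
  shows "(\<Sum>e\<in>cut n S. stripe_solution n \<phi> e) =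
    ((\<Sum>i = 1..ell n \<phi>. (real (g_seq n \<phi> (i - 1)) - real (g_seq n \<phi> i)) *
        (\<Sum>v\<in>{0..<int n}. \<bar>f S v - f S (v + int (\<phi> i))\<bar>)) +
     (\<Sum>v\<in>{0..<int n}. \<bar>f S v - f S (v + int (\<phi> (ell n \<phi>)))\<bar>)) / real n"
proof -
  have "n \<ge> 2" using assms(1) by simp
  note l = ell_props[OF this \<phi>]
  have eq: "(\<Sum>v\<in>{0..<int n}. of_bool (card (circ_edge n (\<phi> i) v \<inter> S) = 1)) =
      (\<Sum>v\<in>{0..<int n}. \<bar>f S v - f S (v + int (\<phi> i))\<bar>)"
    if "i \<in> {1..ell n \<phi>}" for i
  proof (intro sum.cong refl)
    fix v
    have "i \<in> {1..n div 2}" using that l(2) by auto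
    then have "\<phi> i \<in> {1..n div 2}" using permutes_in_image[OF \<phi>] by blast
    then show "of_bool (card (circ_edge n (\<phi> i) v \<inter> S) = 1) = \<bar>f S v - f S (v + int (\<phi> i))\<bar>"
      unfolding f_def using assms(1) by (intro card_circ_edge_Int) auto
  qed
  have "ell n \<phi> \<in> {1..ell n \<phi>}" using l(1) by simp
  from eq[OF this] show ?thesis
    unfolding cut_sum sum_stripe_solution[OF \<open>n \<ge> 2\<close> \<phi>]
    by (simp only: eq cong: sum.cong)
qed

lemma sum_g_seq_diff:
  "(\<Sum>i = 1..l. real (g_seq n \<phi> (i - 1)) - real (g_seq n \<phi> i)) = real n - real (g_seq n \<phi> l)"
  by (induction l) auto

text \<open>A single vertex has variation 2 along every stripe. The coefficients telescope to n - 1,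
  and the extra copy of the last stripe completes them to n.\<close>

lemma stripe_solution_degree:
  assumes "n \<ge> 3" and \<phi>: "\<phi> permutes {1..n div 2}" and u: "u \<in> vertices n"
  shows "(\<Sum>e\<in>cut n {u}. stripe_solution n \<phi> e) = 2"
proof -
  define f where "f v = (of_bool (vert n v \<in> {u}) :: real)" for v
  have npos: "n > 0" using assms by simp
  have per: "f (v mod int n) = f v" for v using npos by (simp add: f_def)
  have single: "(\<Sum>v\<in>{0..<int n}. f v) = 1"
  proof -
    have "vert n v = u \<longleftrightarrow> v = int u mod int n" if "v \<in> {0..<int n}" for v
      using vert_eq_iff_less[OF that, of "int u mod int n"] npos u by (simp add: vert_of_nat)
    then have "(\<Sum>v\<in>{0..<int n}. f v) = (\<Sum>v\<in>{0..<int n}. if v = int u mod int n then 1 else 0)"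
      unfolding f_def by (intro sum.cong) auto
    then show ?thesis using npos by simp
  qed
  have two: "(\<Sum>v\<in>{0..<int n}. \<bar>f v - f (v + int (\<phi> i))\<bar>) = 2" if "i \<in> {1..ell n \<phi>}" for i
  proof -
    have "i \<in> {1..n div 2}" using that ell_props(2)[OF _ \<phi>] assms(1) by auto
    then have "\<phi> i \<in> {1..n div 2}" using permutes_in_image[OF \<phi>] by blast
    then have "vert n v \<noteq> vert n (v + int (\<phi> i))" for v using assms(1) by (intro vert_add_neq) auto
    then have "\<bar>f v - f (v + int (\<phi> i))\<bar> = f v + f (v + int (\<phi> i))" for v by (auto simp: f_def)
    moreover have "(\<Sum>v\<in>{0..<int n}. f (v + int (\<phi> i))) = 1"
    proof -
      have "(\<Sum>v\<in>residue_class n (Suc 0) 0. f (v + int (\<phi> i))) =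
          (\<Sum>v\<in>residue_class n (Suc 0) (0 + int (\<phi> i)). f v)"
        by (rule sum_residue_class_shift) (use npos per in simp_all)
      then show ?thesis unfolding residue_class_Suc_0 single .
    qed
    ultimately show ?thesis using single by (simp add: sum.distrib)
  qed
  have l: "ell n \<phi> \<in> {1..ell n \<phi>}" "g_seq n \<phi> (ell n \<phi>) = 1"
    using ell_props(1,3)[OF _ \<phi>] assms(1) by simp_all
  have deg: "(\<Sum>i = 1..ell n \<phi>. (real (g_seq n \<phi> (i - 1)) - real (g_seq n \<phi> i)) *
        (\<Sum>v\<in>{0..<int n}. \<bar>f v - f (v + int (\<phi> i))\<bar>)) = (real n - 1) * 2"
  proof -
    have "(\<Sum>i = 1..ell n \<phi>. (real (g_seq n \<phi> (i - 1)) - real (g_seq n \<phi> i)) *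
          (\<Sum>v\<in>{0..<int n}. \<bar>f v - f (v + int (\<phi> i))\<bar>)) =
        (\<Sum>i = 1..ell n \<phi>. real (g_seq n \<phi> (i - 1)) - real (g_seq n \<phi> i)) * 2"
      unfolding sum_distrib_right by (intro sum.cong refl) (simp only: two)
    then show ?thesis unfolding sum_g_seq_diff l(2) by simp
  qed
  show ?thesis
    unfolding stripe_solution_cut[OF assms(1) \<phi>] f_def[symmetric] deg two[OF l(1)]
    using npos by (simp add: field_simps)
qed

lemma stripe_solution_subtour:
  assumes "n \<ge> 3" and \<phi>: "\<phi> permutes {1..n div 2}" and S: "S \<noteq> {}" "S \<subset> vertices n"
  shows "(\<Sum>e\<in>cut n S. stripe_solution n \<phi> e) \<ge> 2"
proof -
  define f where "f v = (of_bool (vert n v \<in> S) :: real)" for v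
  have npos: "n > 0" using assms by simp
  note l = ell_props[OF _ \<phi>]
  obtain i where i: "ell n \<phi> = Suc i" using l(1) assms(1) by (cases "ell n \<phi>") auto
  \<comment> \<open>Minimality of \<open>ell\<close> applies only to indices from 1 on; index 0 is
    excluded by g_0 = n \<ge> 3.\<close>
  have "g_seq n \<phi> i \<noteq> 1"
  proof
    assume g: "g_seq n \<phi> i = 1"
    then have "i \<noteq> 0" using assms(1) by (cases i) auto
    then have "ell n \<phi> \<le> i"
      unfolding ell_def using g i l(2) assms(1) by (intro Least_le) auto
    then show False using i by simp
  qed
  obtain a b where ab: "a \<in> S" "b \<in> vertices n" "b \<notin> S" using S by blast
  then have V: "a \<in> vertices n" using S by blast
  have fv: "f (int u mod int n) = of_bool (u \<in> S)" if "u \<in> vertices n" for u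
    using npos that by (simp add: f_def vert_of_nat)
  have "layered_cut n \<phi> f (Suc i) 0 + (\<Sum>v\<in>{0..<int n}. \<bar>f v - f (v + int (\<phi> (Suc i)))\<bar>) \<ge> 2 * real n"
  \<comment> \<open>The witnesses are reduced mod n because vertex n is represented by 0.\<close>
  proof (rule layered_cut_top[where a = "int a mod int n" and b = "int b mod int n"])
    show "g_seq n \<phi> (Suc i) = 1" using l(3) assms(1) i by simp
  qed (use npos \<open>g_seq n \<phi> i \<noteq> 1\<close> ab V fv in \<open>simp_all add: f_def\<close>)
  then have "2 * real n / real n \<le> (\<Sum>e\<in>cut n S. stripe_solution n \<phi> e)"
    unfolding stripe_solution_cut[OF assms(1) \<phi>] f_def[symmetric] layered_cut_def i
    using l(3) assms(1) i
    by (intro divide_right_mono) (simp_all add: residue_class_Suc_0 del: g_seq.simps sum.cl_ivl_Suc)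
  then show ?thesis using npos by simp
qed

lemma stripe_solution_bounds:
  assumes "n \<ge> 3" and \<phi>: "\<phi> permutes {1..n div 2}" and "e \<in> edges n"
  shows "0 \<le> stripe_solution n \<phi> e \<and> stripe_solution n \<phi> e \<le> 1"
proof -
  have npos: "n > 0" using assms by simp
  obtain k where k: "k \<in> {1..n div 2}" "e \<in> stripe n k"
    using assms(3) edges_eq_stripes[OF npos] by blast
  define i where "i = inv \<phi> k"
  have i: "\<phi> i = k" "i \<in> {1..n div 2}"
    using k \<phi> permutes_in_image[OF permutes_inv[OF \<phi>], of k] by (simp_all add: i_def permutes_inverses)
  have x: "stripe_solution n \<phi> e = stripe_weight n \<phi> i"
    using stripe_solution_stripe[OF \<phi>, of e i] i k by simp
  obtain j where j: "i = Suc j" using i by (cases i) auto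
  then have i1: "i - 1 = j" by simp
  have g: "g_seq n \<phi> i \<le> g_seq n \<phi> j" "g_seq n \<phi> j \<le> n" "g_seq n \<phi> i > 0"
    using g_seq_mono[OF npos] g_seq_pos[OF npos] dvd_imp_le[OF g_seq_dvd_n npos] j by auto
  \<comment> \<open>This keeps the doubled weight at most 1 when length n/2 is not the first in the
    order.\<close>
  have half: "2 * g_seq n \<phi> j \<le> n" if "j \<noteq> 0"
  proof -
    have "g_seq n \<phi> j dvd \<phi> 1" using that by (intro g_seq_dvd) auto
    moreover have "\<phi> 1 \<in> {1..n div 2}" using permutes_in_image[OF \<phi>, of 1] assms(1) by simp
    ultimately have "g_seq n \<phi> j \<le> n div 2" by (auto dest: dvd_imp_le)
    then show ?thesis by simp
  qed
  \<comment> \<open>If length n/2 comes first, g_1 = n/2 and the doubled weight 2 (n - n/2) / n is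
    exactly 1.\<close>
  have zero: "g_seq n \<phi> i = k" if "j = 0" "2 * k = n"
    using that i j by (auto simp: gcd_nat.absorb1)
  have "g_seq n \<phi> (ell n \<phi>) = 1" using ell_props(3)[OF _ \<phi>] assms(1) by simp
  show ?thesis
  proof (cases "2 * k = n")
    case False
    then show ?thesis unfolding x stripe_weight_def i1 using g i j npos by (auto simp: field_simps)
  next
    case True
    \<comment> \<open>The excluded combination would give weight 2, but it forces n/2 = g_1 = 1,
      that is n = 2.\<close>
    have "i \<noteq> ell n \<phi> \<or> j \<noteq> 0" 
    proof (rule ccontr)
      assume "\<not> (i \<noteq> ell n \<phi> \<or> j \<noteq> 0)"
      then have "k = 1" using zero[OF _ True] \<open>g_seq n \<phi> (ell n \<phi>) = 1\<close> by simp
      then show False using True assms(1) by simp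
    qed
    then show ?thesis
      unfolding x stripe_weight_def i1 using g i j npos True half zero
      by (cases "j = 0") (auto simp: field_simps)
  qed
qed

lemma stripe_solution_feasible:
  assumes "n \<ge> 3" "\<phi> permutes {1..n div 2}"
  shows "subtour_feasible n (stripe_solution n \<phi>)"
  unfolding subtour_feasible_def
  using stripe_solution_degree[OF assms] stripe_solution_subtour[OF assms] stripe_solution_bounds[OF assms]
  by blast

section \<open>Cost of the stripe solution\<close>

lemma edge_length_circ_edge:
  assumes "0 < k" "2 * k \<le> n" "v \<in> {0..<int n}"
  shows "edge_length n (circ_edge n k v) = k"
  using assms by (intro edge_length_stripe) (simp add: stripe_eq_image)

lemma stripe_solution_objective:
  assumes "n \<ge> 3" and \<phi>: "\<phi> permutes {1..n div 2}"
  shows "objective n (edge_cost n c) (stripe_solution n \<phi>) = VDV n c \<phi>"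
proof -
  have l: "1 \<le> ell n \<phi>" "ell n \<phi> \<le> n div 2" using ell_props[OF _ \<phi>] assms(1) by auto
  have "edge_cost n c (circ_edge n (\<phi> i) v) = c (\<phi> i)" if "i \<in> {1..ell n \<phi>}" "v \<in> {0..<int n}" for i v
  proof -
    have "\<phi> i \<in> {1..n div 2}" using permutes_in_image[OF \<phi>, of i] that l by simp
    then show ?thesis unfolding edge_cost_def using that by (subst edge_length_circ_edge) auto
  qed
  moreover have "ell n \<phi> \<in> {1..ell n \<phi>}" using l by simp
  ultimately have "(\<Sum>v\<in>{0..<int n}. edge_cost n c (circ_edge n (\<phi> i) v)) = real n * c (\<phi> i)"
    if "i \<in> {1..ell n \<phi>}" for i using that by simp
  note s = this
  have "objective n (edge_cost n c) (stripe_solution n \<phi>) =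
      (\<Sum>e\<in>edges n. stripe_solution n \<phi> e * edge_cost n c e)"
    by (simp add: objective_def mult.commute)
  also have "\<dots> = ((\<Sum>i = 1..ell n \<phi>. (real (g_seq n \<phi> (i - 1)) - real (g_seq n \<phi> i)) * (real n * c (\<phi> i))) +
     real n * c (\<phi> (ell n \<phi>))) / real n"
    using assms(1) l by (simp add: sum_stripe_solution[OF _ \<phi>] s)
  also have "\<dots> = VDV n c \<phi>"
  proof -
    have "(\<Sum>i = 1..ell n \<phi>. (real (g_seq n \<phi> (i - 1)) - real (g_seq n \<phi> i)) * (real n * c (\<phi> i))) +
        real n * c (\<phi> (ell n \<phi>)) = real n * VDV n c \<phi>"
      unfolding VDV_def by (simp add: sum_distrib_left algebra_simps)
    then show ?thesis using assms(1) by simp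
  qed
  finally show ?thesis .
qed

section \<open>The lower bound\<close>

text \<open>Each of the g classes mod g imposes a cut of weight at least 2. An edge whose length is
  divisible by g stays inside a class, and any other edge lies in exactly two of these cuts.\<close>

lemma mass_not_dvd_ge:
  assumes feas: "subtour_feasible n y" and n: "n \<ge> 3" and g: "g dvd n" "g \<noteq> 1"
  shows "(\<Sum>e\<in>edges n. y e * of_bool (\<not> g dvd edge_length n e)) \<ge> real g"
proof -
  define C where "C \<rho> = {i \<in> vertices n. i mod g = \<rho>}" for \<rho>
  have gpos: "g \<ge> 2" using g n by (cases g rule: nat.exhaust) (auto simp: Suc_le_eq gr0_conv_Suc)
  have gn: "g \<le> n" using g n by (auto dest: dvd_imp_le)
  have ne: "C \<rho> \<noteq> {}" if "\<rho> < g" for \<rho>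
  proof -
    \<comment> \<open>Vertices start at 1, so the class of 0 is represented by g.\<close>
    have "(if \<rho> = 0 then g else \<rho>) \<in> C \<rho>"
      using that gn gpos by (auto simp: C_def vertices_def)
    then show ?thesis by blast
  qed
  have proper: "C \<rho> \<subset> vertices n" if "\<rho> < g" for \<rho>
  proof -
    define \<sigma> :: nat where "\<sigma> = (if \<rho> = 0 then 1 else 0)"
    have "\<sigma> < g" "\<sigma> \<noteq> \<rho>" using gpos by (auto simp: \<sigma>_def)
    then obtain i where "i \<in> C \<sigma>" "i \<notin> C \<rho>" using ne[of \<sigma>] by (auto simp: C_def)
    then show ?thesis by (auto simp: C_def)
  qed
  have count: "(\<Sum>\<rho><g. of_bool (card (e \<inter> C \<rho>) = 1)) \<le> (2 * of_bool (\<not> g dvd edge_length n e) :: real)"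
    if e: "e \<in> edges n" for e
  proof -
    obtain a b where ab: "e = {a, b}" "a \<noteq> b" using e by (auto simp: edges_def card_2_iff)
    have V: "a \<in> vertices n" "b \<in> vertices n" using e ab by (auto simp: edges_def)
    have c1: "card (e \<inter> C \<rho>) = 1 \<longleftrightarrow> (a mod g = \<rho>) \<noteq> (b mod g = \<rho>)" for \<rho>
      using V ab by (auto simp: C_def Int_insert_left)
    have "(\<Sum>\<rho><g. of_bool (card (e \<inter> C \<rho>) = 1)) = real (card {\<rho>\<in>{..<g}. (a mod g = \<rho>) \<noteq> (b mod g = \<rho>)})"
      unfolding c1 by (simp add: sum_of_bool_eq Int_def)
    also have "\<dots> \<le> 2 * of_bool (\<not> g dvd edge_length n e)"
    proof (cases "g dvd edge_length n e")
      case True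
      have "edge_length n e = circ_dist n a b" using e ab by (simp add: edge_length_doubleton)
      then have "int g dvd int (circ_dist n a b)" using True by simp
      then have "int g dvd (int a - int b) mod int n \<or> int g dvd (int b - int a) mod int n"
        using n unfolding circ_dist_def by (auto simp: min_def split: if_splits)
      then have "int g dvd int a - int b \<or> int g dvd int b - int a"
        using g by (simp add: dvd_mod_iff)
      then have "int g dvd int a - int b" by (metis dvd_minus_iff minus_diff_eq)
      then have "a mod g = b mod g" by (metis mod_eq_dvd_iff of_nat_eq_iff of_nat_mod)
      then show ?thesis by simp
    next
      case False
      have "card {\<rho>\<in>{..<g}. (a mod g = \<rho>) \<noteq> (b mod g = \<rho>)} \<le> card {a mod g, b mod g}"
        by (intro card_mono) auto
      also have "\<dots> \<le> 2" by (simp add: card_insert_if)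
      finally show ?thesis using False by simp
    qed
    finally show ?thesis .
  qed
  have "2 * real g = (\<Sum>\<rho><g. 2)" by simp
  also have "\<dots> \<le> (\<Sum>\<rho><g. \<Sum>e\<in>cut n (C \<rho>). y e)"
    using feas ne proper unfolding subtour_feasible_def by (intro sum_mono) auto
  also have "\<dots> = (\<Sum>e\<in>edges n. y e * (\<Sum>\<rho><g. of_bool (card (e \<inter> C \<rho>) = 1)))"
    unfolding cut_sum sum_distrib_left by (rule sum.swap)
  also have "\<dots> \<le> (\<Sum>e\<in>edges n. y e * (2 * of_bool (\<not> g dvd edge_length n e)))"
    using feas count unfolding subtour_feasible_def by (intro sum_mono mult_left_mono) auto
  also have "\<dots> = 2 * (\<Sum>e\<in>edges n. y e * of_bool (\<not> g dvd edge_length n e))"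
    unfolding sum_distrib_left by (intro sum.cong refl) simp
  finally show ?thesis by simp
qed

text \<open>Passing from j to j + 1 in the inductive inequality adds (c_(j+1) - c_j) G_j on the left
  and (c_(j+1) - c_j) M_j on the right, so monotone costs and the tail bounds suffice; the start
  uses c_1 \<ge> 0.\<close>

lemma abel_summation_ge:
  fixes c m G :: "nat \<Rightarrow> real"
  assumes l: "1 \<le> l" "l \<le> d"
    and c: "0 \<le> c 1" and mono: "\<And>i j. 1 \<le> i \<Longrightarrow> i \<le> j \<Longrightarrow> j \<le> d \<Longrightarrow> c i \<le> c j"
    and m: "\<And>i. i \<in> {1..d} \<Longrightarrow> 0 \<le> m i"
    and tail: "\<And>j. j < l \<Longrightarrow> G j \<le> (\<Sum>i = Suc j..d. m i)"
  shows "(\<Sum>i = 1..l. (G (i - 1) - G i) * c i) + G l * c l \<le> (\<Sum>i = 1..d. c i * m i)"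
proof -
  define M where "M j = (\<Sum>i = Suc j..d. m i)" for j
  have M: "M j = m (Suc j) + M (Suc j)" if "j < d" for j
    unfolding M_def using that by (simp add: sum.atLeast_Suc_atMost)
  have "(\<Sum>i = 1..j. (G (i - 1) - G i) * c i) + G j * c j \<le> (\<Sum>i = 1..j. c i * m i) + c j * M j"
    if "1 \<le> j" "j \<le> l" for j
    using that
  proof (induction j rule: dec_induct)
    case base
    have "G 0 * c 1 \<le> M 0 * c 1" using tail[of 0] l c by (intro mult_right_mono) (auto simp: M_def)
    then show ?case using M[of 0] l by (simp add: algebra_simps)
  next
    case (step j)
    have "(c (Suc j) - c j) * G j \<le> (c (Suc j) - c j) * M j"
      using tail[of j] mono[of j "Suc j"] step l by (intro mult_left_mono) (auto simp: M_def)
    then show ?case using step M[of j] l by (simp add: algebra_simps)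
  qed
  from this[of l] have "(\<Sum>i = 1..l. (G (i - 1) - G i) * c i) + G l * c l \<le> (\<Sum>i = 1..l. c i * m i) + c l * M l"
    using l by simp
  \<comment> \<open>So far the mass beyond l was charged only c_l; its true cost is no
    smaller.\<close>
  also have "c l * M l \<le> (\<Sum>i = Suc l..d. c i * m i)"
    unfolding M_def sum_distrib_left using l mono m by (intro sum_mono mult_right_mono) auto
  also have "(\<Sum>i = 1..l. c i * m i) + (\<Sum>i = Suc l..d. c i * m i) = (\<Sum>i = 1..d. c i * m i)"
    using sum.ub_add_nat[of 1 l "\<lambda>i. c i * m i" "d - l"] l by simp
  finally show ?thesis by simp
qed

lemma VDV_le_objective:
  assumes "n \<ge> 3" and c: "\<forall>k\<in>{1..n div 2}. 0 \<le> c k" and sp: "stripe_permutation n c \<phi>"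
    and feas: "subtour_feasible n y"
  shows "VDV n c \<phi> \<le> objective n (edge_cost n c) y"
proof -
  have \<phi>: "\<phi> permutes {1..n div 2}" and mono: "mono_on {1..n div 2} (\<lambda>i. c (\<phi> i))"
    using sp by (auto simp: stripe_permutation_def)
  have npos: "n > 0" using assms(1) by simp
  have l: "1 \<le> ell n \<phi>" "ell n \<phi> \<le> n div 2" "g_seq n \<phi> (ell n \<phi>) = 1"
    using ell_props[OF _ \<phi>] assms(1) by auto
  define m where "m i = (\<Sum>e\<in>stripe n (\<phi> i). y e)" for i
  have m: "m i \<ge> 0" for i
    unfolding m_def using feas stripe_subset_edges[of n "\<phi> i"]
    by (intro sum_nonneg) (auto simp: subtour_feasible_def)
  have obj: "objective n (edge_cost n c) y = (\<Sum>i = 1..n div 2. c (\<phi> i) * m i)"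
    unfolding objective_def sum_edges[OF npos \<phi>] m_def sum_distrib_left
    by (intro sum.cong refl) (simp add: edge_cost_def edge_length_stripe)
  have tail: "real (g_seq n \<phi> j) \<le> (\<Sum>i = Suc j..n div 2. m i)" if j: "j < ell n \<phi>" for j
  proof -
    define g where "g = g_seq n \<phi> j"
    have "g \<noteq> 1"
    proof
      assume g: "g = 1"
      then have "j \<noteq> 0" using assms(1) by (cases j) (auto simp: g_def)
      then have "ell n \<phi> \<le> j"
        unfolding ell_def using g l(2) j by (intro Least_le) (auto simp: g_def)
      then show False using j by simp
    qed
    then have "real g \<le> (\<Sum>e\<in>edges n. y e * of_bool (\<not> g dvd edge_length n e))"
      using mass_not_dvd_ge[OF feas assms(1)] g_seq_dvd_n by (simp add: g_def)
    also have "\<dots> = (\<Sum>i = 1..n div 2. m i * of_bool (\<not> g dvd \<phi> i))"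
      unfolding sum_edges[OF npos \<phi>] m_def sum_distrib_right
      by (intro sum.cong refl) (simp add: edge_length_stripe)
    \<comment> \<open>The first j lengths are all divisible by g_j and drop out.\<close>
    also have "\<dots> = (\<Sum>i = Suc j..n div 2. m i * of_bool (\<not> g dvd \<phi> i))"
      using g_seq_dvd by (intro sum.mono_neutral_right) (auto simp: g_def)
    also have "\<dots> \<le> (\<Sum>i = Suc j..n div 2. m i)" using m by (intro sum_mono) simp
    finally show ?thesis by (simp add: g_def)
  qed
  have "\<phi> 1 \<in> {1..n div 2}" using permutes_in_image[OF \<phi>, of 1] l by simp
  then have "(\<Sum>i = 1..ell n \<phi>. (real (g_seq n \<phi> (i - 1)) - real (g_seq n \<phi> i)) * c (\<phi> i)) +
      real (g_seq n \<phi> (ell n \<phi>)) * c (\<phi> (ell n \<phi>)) \<le> (\<Sum>i = 1..n div 2. c (\<phi> i) * m i)"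
    using l c m tail mono_onD[OF mono]
    by (intro abel_summation_ge[where c = "\<lambda>i. c (\<phi> i)"]) auto
  then show ?thesis unfolding VDV_def obj using l(3) by simp
qed

theorem theorem3:
  fixes n :: nat and c :: "nat \<Rightarrow> real" and \<phi> :: "nat \<Rightarrow> nat"
  assumes "n \<ge> 3"
    and "\<forall>k\<in>{1..n div 2}. 0 \<le> c k"
    and "stripe_permutation n c \<phi>"
  shows "VDV n c \<phi> = LPOPT n (edge_cost n c) \<and>
         subtour_optimal n (edge_cost n c) (stripe_solution n \<phi>)"
proof -
  have \<phi>: "\<phi> permutes {1..n div 2}" using assms(3) by (simp add: stripe_permutation_def)
  have "subtour_optimal n (edge_cost n c) (stripe_solution n \<phi>)"
    unfolding subtour_optimal_def stripe_solution_objective[OF assms(1) \<phi>]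
    using stripe_solution_feasible[OF assms(1) \<phi>] VDV_le_objective[OF assms] by blast
  then show ?thesis
    using LPOPT_eq_objective stripe_solution_objective[OF assms(1) \<phi>] by metis
qed

end
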